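(* Let $\Gamma$ be a weighted graph on a finite vertex set $V=X\sqcup Y$ with input vertices $X$ and output vertices $Y$. Suppose that $\Gamma$ is associated with a quantum error correcting code (in the sense recalled in the context), and that it has $v$ vertices, $l$ edges and no edges between input vertices. Then the operator $F_X\mathbf u_\Gamma F_X^*$ on $l_2(\mathbb{Z}_d^V)$ is a product of $v+l$ elementary gates, each being either a controlled shift gate or a local Fourier transform.
   Context: Fix a number of levels $d$ (a positive integer), and write $\mathbb{Z}_d$ for the integers mod $d$. For $g,h\in\mathbb{Z}_d$ put $\chi(g|h)=\exp\left(\frac{2\pi i}{d}gh\right)$. A weighted graph $\Gamma$ on a finite vertex set $V$ is a symmetric matrix $(\Gamma(i,j)\mid i,j\in V)$ of integers. For $i\neq j$, $\Gamma(i,j)$ is the weight of the edge $\{i,j\}$, and $\Gamma(i,j)=0$ means that there is no edge between $i$ and $j$. The edges are thus the two-element subsets $\{i,j\}\subset V$ with $\Gamma(i,j)\neq 0$. The vertex set is split into a set $X\subset V$ of input vertices and the set $Y=V\setminus X$ of output vertices. $l_2(\mathbb{Z}_d^V)$ is the Hilbert space of complex functions on $\mathbb{Z}_d^V$, with orthonormal basis $|\mathbf g\rangle$, $\mathbf g=(g_i\mid i\in V)\in\mathbb{Z}_d^V$; similarly for $X$ and $Y$ in place of $V$. Gates: the local Fourier transform $F_i$ ($i\in V$) is the unitary $F_i|\mathbf g\rangle=\frac1{\sqrt d}\sum_{h\in\mathbb{Z}_d}\chi(g_i|h)\,|h,\mathbf g^i\rangle$, where $|h,\mathbf g^i\rangle$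 is $|\mathbf g\rangle$ with $i$-th entry replaced by $h$. For $K\subset V$ put $F_K=\prod_{k\in K}F_k$. The ($n$-)controlled shift gate $\mathbf c(i,j)^n$ ($i\neq j$ in $V$, $n$ an integer) is the unitary replacing the $j$-th entry $g_j$ of $|\mathbf g\rangle$ by $g_j+ng_i$; for each $n$ it counts as one gate. The $n$-controlled phase gate is $\mathbf u(i,j)^n=F_j\mathbf c(i,j)^nF_j^*=F_i\mathbf c(j,i)^nF_i^*$. The cluster state creation operator is $\mathbf u_\Gamma=\Big(\prod_{\{i,j\}\subset V}\mathbf u(i,j)^{\Gamma(i,j)}\Big)\prod_{j\in V}F_j$, the first product being over all two-element subsets of $V$. Graph code: let $\Psi_\Gamma(\mathbf g)=d^{-\frac12|V|}\prod_{\{i,j\}\subset V}\chi(g_i|g_j)^{\Gamma(i,j)}$ be the cluster state wave function, and let $\mathbf v_\Gamma:l_2(\mathbb{Z}_d^X)\to l_2(\mathbb{Z}_d^Y)$ be the linear map $\mathbf v_\Gamma|\mathbf h\rangle=d^{\frac12|X|}\sum_{\mathbf g\in\mathbb{Z}_d^Y}\Psi_\Gamma(\mathbf h,\mathbf g)\,|\mathbf g\rangle$, $\mathbf h\in\mathbb{Z}_d^X$. That $\Gamma$ (with the chosen inputs and outputs) is associated with a quantum error correcting code is meant in the sense of Schlingemann and Werner, "Quantum error-correcting codes associated with graphs": $\mathbf v_\Gamma$ is the coding map of a quantum error correcting code whose protected subspace is the range of $\mathbf v_\Gamma$ in $l_2(\mathbb{Z}_d^Y)$. For such $\Gamma$ the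 map $\mathbf v_\Gamma$ is automatically an isometry, $\mathbf v_\Gamma^*\mathbf v_\Gamma=1$; this is a consequence of the hypothesis, not its definition. *)

theory Defs
  imports Complex_Main "HOL-Library.FuncSet"
begin

text \<open>Elements of \<open>\<int>\<^sub>d\<close> are represented by their residues in \<open>{0..<d}\<close>, and elements of
  \<open>\<int>\<^sub>d\<^sup>V\<close> by extensional functions on \<open>V\<close>.\<close>

definition cfg :: "nat \<Rightarrow> 'v set \<Rightarrow> ('v \<Rightarrow> int) set" where
  "cfg d V = (V \<rightarrow>\<^sub>E {0..<int d})"

definition chi :: "nat \<Rightarrow> int \<Rightarrow> int \<Rightarrow> complex" where
  "chi d g h = exp (2 * of_real pi * \<i> / of_nat d * (of_int g * of_int h))"

type_synonym 'v wave = "('v \<Rightarrow> int) \<Rightarrow> complex"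
type_synonym 'v oper = "'v wave \<Rightarrow> 'v wave"

text \<open>A vector of \<open>l\<^sub>2(\<int>\<^sub>d\<^sup>V)\<close> is a function vanishing outside \<open>cfg d V\<close>. Operators are total
  functions, so two operators on \<open>l\<^sub>2(\<int>\<^sub>d\<^sup>V)\<close> are the same if they agree on \<open>l2 d V\<close>.\<close>

definition l2 :: "nat \<Rightarrow> 'v set \<Rightarrow> 'v wave set" where
  "l2 d V = {\<psi>. \<forall>g. g \<notin> cfg d V \<longrightarrow> \<psi> g = 0}"

definition ket :: "('v \<Rightarrow> int) \<Rightarrow> 'v wave" where
  "ket g = (\<lambda>h. if h = g then 1 else 0)"

definition linear_op :: "nat \<Rightarrow> 'v set \<Rightarrow> 'v set \<Rightarrow> 'v oper \<Rightarrow> bool" where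
  "linear_op d A B T \<longleftrightarrow>
     (\<forall>\<psi>\<in>l2 d A. T \<psi> \<in> l2 d B) \<and>
     (\<forall>\<psi>\<in>l2 d A. \<forall>\<phi>\<in>l2 d A. \<forall>c. T (\<lambda>g. c * \<psi> g + \<phi> g) = (\<lambda>k. c * T \<psi> k + T \<phi> k))"

text \<open>The linear map on \<open>l\<^sub>2(\<int>\<^sub>d\<^sup>V)\<close> that sends each basis vector \<open>ket g\<close> to \<open>f g\<close>.\<close>

definition lin_ext :: "nat \<Rightarrow> 'v set \<Rightarrow> (('v \<Rightarrow> int) \<Rightarrow> 'v wave) \<Rightarrow> 'v oper" where
  "lin_ext d V f \<psi> = (\<lambda>k. \<Sum>g\<in>cfg d V. \<psi> g * f g k)"

definition inner_prod :: "nat \<Rightarrow> 'v set \<Rightarrow> 'v wave \<Rightarrow> 'v wave \<Rightarrow> complex" where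
  "inner_prod d V \<phi> \<psi> = (\<Sum>g\<in>cfg d V. cnj (\<phi> g) * \<psi> g)"

text \<open>The adjoint of \<open>T : l\<^sub>2(\<int>\<^sub>d\<^sup>A) \<rightarrow> l\<^sub>2(\<int>\<^sub>d\<^sup>B)\<close>; its \<open>g\<close>-th coordinate is
  \<open>\<langle>g|T\<^sup>* \<phi>\<rangle> = \<langle>T g|\<phi>\<rangle>\<close>.\<close>

definition adj :: "nat \<Rightarrow> 'v set \<Rightarrow> 'v set \<Rightarrow> 'v oper \<Rightarrow> 'v oper" where
  "adj d A B T \<phi> = (\<lambda>g. if g \<in> cfg d A then inner_prod d B (T (ket g)) \<phi> else 0)"

text \<open>Product of a finite family of pairwise commuting operators.\<close>

definition comm_prod :: "('i \<Rightarrow> 'v oper) \<Rightarrow> 'i set \<Rightarrow> 'v oper" where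
  "comm_prod f K = Finite_Set.fold (\<lambda>k T. f k \<circ> T) id K"

definition two_subsets :: "'v set \<Rightarrow> 'v set set" where
  "two_subsets V = {e. e \<subseteq> V \<and> card e = 2}"

text \<open>A function of two vertices that is symmetric for distinct arguments, regarded as a function
  on two-element sets: \<open>on_pair f {i, j} = f i j\<close> (see \<open>on_pair_eq\<close>).\<close>

definition on_pair :: "('v \<Rightarrow> 'v \<Rightarrow> 'b) \<Rightarrow> 'v set \<Rightarrow> 'b" where
  "on_pair f e = (SOME z. \<exists>i j. i \<noteq> j \<and> e = {i, j} \<and> z = f i j)"

lemma on_pair_eq:
  assumes "i \<noteq> j" and "f i j = f j i"
  shows "on_pair f {i, j} = f i j"
  unfolding on_pair_def
proof (rule some_equality)
  show "\<exists>a b. a \<noteq> b \<and> {i, j} = {a, b} \<and> f i j = f a b"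
    using assms(1) by blast
next
  fix z assume "\<exists>a b. a \<noteq> b \<and> {i, j} = {a, b} \<and> z = f a b"
  then obtain a b where "a \<noteq> b" "{i, j} = {a, b}" "z = f a b"
    by blast
  then show "z = f i j"
    using assms(2) by (metis doubleton_eq_iff)
qed

lemma comm_prod_empty: "comm_prod f {} = id"
  by (simp add: comm_prod_def)

lemma comm_prod_insert:
  assumes "finite K" and "k \<notin> K"
    and "\<And>a b. a \<in> insert k K \<Longrightarrow> b \<in> insert k K \<Longrightarrow> f a \<circ> f b = f b \<circ> f a"
  shows "comm_prod f (insert k K) = f k \<circ> comm_prod f K"
proof -
  interpret comp_fun_commute_on "insert k K" "\<lambda>k T. f k \<circ> T"
  proof
    fix a b assume "a \<in> insert k K" "b \<in> insert k K"
    then show "(\<lambda>T. f b \<circ> T) \<circ> (\<lambda>T. f a \<circ> T) = (\<lambda>T. f a \<circ> T) \<circ> (\<lambda>T. f b \<circ> T)"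
      using assms(3)[of a b] by (simp add: fun_eq_iff)
  qed
  show ?thesis
    unfolding comm_prod_def using assms by (intro fold_insert) auto
qed

definition weighted_graph :: "'v set \<Rightarrow> ('v \<Rightarrow> 'v \<Rightarrow> int) \<Rightarrow> bool" where
  "weighted_graph V \<Gamma> \<longleftrightarrow> finite V \<and> (\<forall>i\<in>V. \<forall>j\<in>V. \<Gamma> i j = \<Gamma> j i)"

definition edges :: "'v set \<Rightarrow> ('v \<Rightarrow> 'v \<Rightarrow> int) \<Rightarrow> 'v set set" where
  "edges V \<Gamma> = {{i, j} | i j. i \<in> V \<and> j \<in> V \<and> i \<noteq> j \<and> \<Gamma> i j \<noteq> 0}"

definition fourier :: "nat \<Rightarrow> 'v set \<Rightarrow> 'v \<Rightarrow> 'v oper" where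
  "fourier d V i = lin_ext d V
     (\<lambda>g k. \<Sum>h = 0..<int d. complex_of_real (1 / sqrt (real d)) * chi d (g i) h * ket (g(i := h)) k)"

definition fourier_set :: "nat \<Rightarrow> 'v set \<Rightarrow> 'v set \<Rightarrow> 'v oper" where
  "fourier_set d V K = comm_prod (fourier d V) K"

definition cshift :: "nat \<Rightarrow> 'v set \<Rightarrow> 'v \<Rightarrow> 'v \<Rightarrow> int \<Rightarrow> 'v oper" where
  "cshift d V i j n = lin_ext d V (\<lambda>g. ket (g(j := (g j + n * g i) mod int d)))"

definition cphase :: "nat \<Rightarrow> 'v set \<Rightarrow> 'v \<Rightarrow> 'v \<Rightarrow> int \<Rightarrow> 'v oper" where
  "cphase d V i j n = fourier d V j \<circ> cshift d V i j n \<circ> adj d V V (fourier d V j)"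

definition cluster_op :: "nat \<Rightarrow> 'v set \<Rightarrow> ('v \<Rightarrow> 'v \<Rightarrow> int) \<Rightarrow> 'v oper" where
  "cluster_op d V \<Gamma> =
     comm_prod (on_pair (\<lambda>i j. cphase d V i j (\<Gamma> i j))) (two_subsets V) \<circ> fourier_set d V V"

definition elementary_gates :: "nat \<Rightarrow> 'v set \<Rightarrow> 'v oper set" where
  "elementary_gates d V =
     {cshift d V i j n | i j n. i \<in> V \<and> j \<in> V \<and> i \<noteq> j} \<union> {fourier d V i | i. i \<in> V}"

definition cluster_wave :: "nat \<Rightarrow> 'v set \<Rightarrow> ('v \<Rightarrow> 'v \<Rightarrow> int) \<Rightarrow> 'v wave" where
  "cluster_wave d V \<Gamma> g = complex_of_real (real d powr (- real (card V) / 2)) *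
     (\<Prod>e\<in>two_subsets V. on_pair (\<lambda>i j. chi d (g i) (g j) powi \<Gamma> i j) e)"

text \<open>For \<open>h \<in> cfg d X\<close> and \<open>g \<in> cfg d Y\<close>, the configuration \<open>(h, g)\<close> on \<open>X \<union> Y\<close> is
  \<open>override_on g h X\<close>.\<close>

definition coding_map :: "nat \<Rightarrow> 'v set \<Rightarrow> 'v set \<Rightarrow> ('v \<Rightarrow> 'v \<Rightarrow> int) \<Rightarrow> 'v oper" where
  "coding_map d X Y \<Gamma> = lin_ext d X
     (\<lambda>h k. complex_of_real (real d powr (real (card X) / 2)) *
        (\<Sum>g\<in>cfg d Y. cluster_wave d (X \<union> Y) \<Gamma> (override_on g h X) * ket g k))"

text \<open>Channels are given in the Heisenberg picture by Kraus operators
  \<open>K : l\<^sub>2(\<int>\<^sub>d\<^sup>A) \<rightarrow> l\<^sub>2(\<int>\<^sub>d\<^sup>B)\<close>, acting as \<open>T \<mapsto> \<Sum> K\<^sup>* T K\<close>. In finite dimension these are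
  exactly the completely positive maps; a channel is moreover unital.\<close>

definition kraus_map :: "nat \<Rightarrow> 'v set \<Rightarrow> 'v set \<Rightarrow> 'v oper list \<Rightarrow> 'v oper \<Rightarrow> 'v oper" where
  "kraus_map d A B Ks T = (\<lambda>\<psi> g. \<Sum>K\<leftarrow>Ks. adj d A B K (T (K \<psi>)) g)"

definition channel :: "nat \<Rightarrow> 'v set \<Rightarrow> 'v set \<Rightarrow> 'v oper list \<Rightarrow> bool" where
  "channel d A B Ks \<longleftrightarrow>
     (\<forall>K\<in>set Ks. linear_op d A B K) \<and> (\<forall>\<psi>\<in>l2 d A. kraus_map d A B Ks id \<psi> = \<psi>)"

text \<open>A linear space of error operators on the output system; ``no error'' is one of the
  possibilities.\<close>

definition error_space :: "nat \<Rightarrow> 'v set \<Rightarrow> 'v oper set \<Rightarrow> bool" where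
  "error_space d Y Err \<longleftrightarrow>
     id \<in> Err \<and> (\<forall>S\<in>Err. linear_op d Y Y S) \<and>
     (\<forall>S\<in>Err. \<forall>T\<in>Err. \<forall>c. (\<lambda>\<psi> g. c * S \<psi> g + T \<psi> g) \<in> Err)"

text \<open>\<open>w : l\<^sub>2(\<int>\<^sub>d\<^sup>X) \<rightarrow> l\<^sub>2(\<int>\<^sub>d\<^sup>Y)\<close> is the coding map of a code correcting the errors in \<open>Err\<close>:
  one recovery channel \<open>R\<close> restores the encoded information after every noisy channel \<open>N\<close>
  with Kraus operators in \<open>Err\<close>, that is \<open>w\<^sup>* N(R(T)) w = T\<close>.\<close>

definition corrects :: "nat \<Rightarrow> 'v set \<Rightarrow> 'v set \<Rightarrow> 'v oper set \<Rightarrow> 'v oper \<Rightarrow> bool" where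
  "corrects d X Y Err w \<longleftrightarrow> linear_op d X Y w \<and>
     (\<exists>Rs. channel d Y X Rs \<and>
        (\<forall>Fs. set Fs \<subseteq> Err \<and> channel d Y Y Fs \<longrightarrow>
           (\<forall>T. linear_op d X X T \<longrightarrow>
              (\<forall>\<psi>\<in>l2 d X.
                 adj d X Y w (kraus_map d Y Y Fs (kraus_map d Y X Rs T) (w \<psi>)) = T \<psi>))))"

text \<open>The isometry property \<open>w\<^sup>* w = 1\<close> is not assumed but follows, by taking the noiseless
  channel and \<open>T = id\<close>.\<close>

lemma adj_id:
  assumes "finite Y" and "\<phi> \<in> l2 d Y"
  shows "adj d Y Y id \<phi> = \<phi>"
proof
  fix g
  have "finite (cfg d Y)"
    using assms(1) by (simp add: cfg_def finite_PiE)
  moreover have "cnj (ket g k) * \<phi> k = (if k = g then \<phi> k else 0)" for k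
    by (simp add: ket_def)
  ultimately show "adj d Y Y id \<phi> g = \<phi> g"
    using assms(2) by (simp add: adj_def inner_prod_def l2_def)
qed

lemma corrects_imp_isometry:
  fixes X Y :: "'a set"
  assumes "finite Y" and "error_space d Y Err" and "corrects d X Y Err w" and "\<psi> \<in> l2 d X"
  shows "adj d X Y w (w \<psi>) = \<psi>"
proof -
  obtain Rs where Rs: "channel d Y X Rs"
    and rec: "\<And>Fs T \<psi>. set Fs \<subseteq> Err \<Longrightarrow> channel d Y Y Fs \<Longrightarrow> linear_op d X X T \<Longrightarrow> \<psi> \<in> l2 d X \<Longrightarrow>
      adj d X Y w (kraus_map d Y Y Fs (kraus_map d Y X Rs T) (w \<psi>)) = T \<psi>"
    and w: "linear_op d X Y w"
    using assms(3) unfolding corrects_def by blast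
  have w\<psi>: "w \<psi> \<in> l2 d Y"
    using w assms(4) by (auto simp: linear_op_def)
  have id: "linear_op d A A id" for A :: "'a set"
    by (simp add: linear_op_def)
  have km: "kraus_map d Y Y [id] T \<phi> = adj d Y Y id (T \<phi>)" for T \<phi>
    by (simp add: kraus_map_def)
  have "channel d Y Y [id]"
    using assms(1) id km by (simp add: channel_def adj_id)
  moreover have "set [id] \<subseteq> Err"
    using assms(2) by (simp add: error_space_def)
  ultimately have "adj d X Y w (kraus_map d Y Y [id] (kraus_map d Y X Rs id) (w \<psi>)) = id \<psi>"
    using rec id assms(4) by blast
  moreover have "kraus_map d Y X Rs id (w \<psi>) = w \<psi>"
    using Rs w\<psi> by (simp add: channel_def)
  ultimately show ?thesis
    using assms(1) w\<psi> by (simp add: km adj_id)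
qed

text \<open>The graph with inputs \<open>X\<close> and outputs \<open>Y\<close> is associated with a quantum code correcting
  the errors in \<open>Err\<close>.\<close>

definition graph_qecc ::
    "nat \<Rightarrow> 'v set \<Rightarrow> 'v set \<Rightarrow> ('v \<Rightarrow> 'v \<Rightarrow> int) \<Rightarrow> 'v oper set \<Rightarrow> bool" where
  "graph_qecc d X Y \<Gamma> Err \<longleftrightarrow>
     error_space d Y Err \<and> corrects d X Y Err (coding_map d X Y \<Gamma>)"

end

(* Put P for the product of all controlled phases; it is diagonal. Since F_V = F_Y F_X, the operator
   is F_X P F_Y on l2. Conjugation by F_m turns a controlled phase into a controlled shift on m, in
   both orders of multiplication. Order the vertices, outputs before inputs, and let P_m be the
   phases on the edges from m to earlier vertices. For outputs, P_m F_m is F_m followed on the right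
   by one shift per edge; for inputs, F_m P_m is F_m preceded on the left by one shift per edge, and
   P_m commutes with the transforms of the other inputs because no edge joins two inputs. *)

theory Submission imports Defs begin

section \<open>Characters of the integers modulo \<open>d\<close> and their orthogonality\<close>

lemma chi_commute: "chi d a b = chi d b a"
  by (simp add: chi_def mult.commute)

lemma chi_add_left: "chi d (a + a') b = chi d a b * chi d a' b"
  by (simp add: chi_def exp_add [symmetric] algebra_simps add_divide_distrib)

lemma chi_0_left [simp]: "chi d 0 b = 1"
  by (simp add: chi_def)

text \<open>The exponent is symmetric in \<open>n\<close>, \<open>a\<close> and \<open>b\<close>.
  This makes the phase on an edge independent of which endpoint is called the control.\<close>

lemma chi_mult_left: "chi d (n * a) b = chi d (n * b) a"
  by (simp add: chi_def ac_simps)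

lemma chi_eq_cis: "chi d a b = cis (2 * pi / d * (a * b))"
  by (simp add: chi_def cis_conv_exp ac_simps)

lemma chi_mult_period:
  assumes "d > 0"
  shows "chi d (int d * q) b = 1"
proof -
  have "2 * pi / d * (int d * q * b) = 2 * pi * of_int (q * b)"
    using assms by simp
  then show ?thesis
    by (simp only: chi_eq_cis cis_multiple_2pi Ints_of_int)
qed

lemma chi_mod_left:
  assumes "d > 0"
  shows "chi d (a mod int d) b = chi d a b"
proof -
  have "chi d a b = chi d (a mod int d + int d * (a div int d)) b"
    by simp
  also have "\<dots> = chi d (a mod int d) b"
    unfolding chi_add_left using assms by (simp add: chi_mult_period)
  finally show ?thesis by simp
qed

lemma cnj_chi: "cnj (chi d a b) = chi d (- a) b"
  by (simp add: chi_eq_cis cis_cnj)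

lemma bij_betw_add_mod:
  assumes "d > 0"
  shows "bij_betw (\<lambda>h. (h + c) mod int d) {0..<int d} {0..<int d}"
proof (rule bij_betw_byWitness [where f' = "\<lambda>h. (h - c) mod int d"])
  show "\<forall>h\<in>{0..<int d}. ((h + c) mod int d - c) mod int d = h"
    by (simp add: mod_simps)
  show "\<forall>h\<in>{0..<int d}. ((h - c) mod int d + c) mod int d = h"
    by (simp add: mod_simps)
qed (use assms in auto)

text \<open>The residues below \<open>d\<close> are in bijection with the \<open>d\<close>-th roots
  of unity, so only the residue 0 gives the root 1.\<close>

lemma chi_eq_1_imp:
  assumes "d > 0" and "chi d 1 a = 1"
  shows "int d dvd a"
proof -
  let ?r = "nat (a mod int d)"
  let ?f = "\<lambda>k. cis (2 * pi * real k / real d)"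
  have "chi d 1 a = chi d 1 (a mod int d)"
    using chi_mod_left [OF assms(1)] by (simp add: chi_commute [of d 1])
  then have "?f ?r = ?f 0"
    using assms by (simp add: chi_eq_cis)
  moreover have "?r < d" using assms(1) by (simp add: nat_less_iff)
  ultimately have "?r = 0"
    using inj_onD [OF bij_betw_imp_inj_on [OF bij_betw_roots_unity [OF assms(1)]], of ?r 0] assms(1)
    by simp
  then have "a mod int d = 0" using assms(1) by (simp add: nat_eq_iff)
  then show ?thesis by blast
qed

text \<open>Translating the summation variable by one multiplies the sum by \<open>chi d 1 a\<close>, so the sum
  vanishes unless this factor is 1.\<close>

lemma sum_chi:
  assumes "d > 0"
  shows "(\<Sum>h = 0..<int d. chi d h a) = (if int d dvd a then of_nat d else 0)"
proof (cases "int d dvd a")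
  case True
  then obtain q where "a = int d * q" by blast
  then have "chi d h a = 1" for h
    using chi_mult_period [OF assms] by (simp add: chi_commute [of d h])
  then show ?thesis using True by simp
next
  case False
  let ?S = "\<Sum>h = 0..<int d. chi d h a"
  have "?S = (\<Sum>h = 0..<int d. chi d ((h + 1) mod int d) a)"
    using sum.reindex_bij_betw [OF bij_betw_add_mod [OF assms], of "\<lambda>h. chi d h a" 1] by simp
  also have "\<dots> = ?S * chi d 1 a"
    using assms by (simp add: chi_mod_left chi_add_left sum_distrib_right)
  finally have "?S * (chi d 1 a - 1) = 0"
    by (simp add: algebra_simps)
  then show ?thesis using False chi_eq_1_imp [OF assms] by auto
qed

section \<open>Diagonal operators and updates of configurations\<close>

text \<open>Values off \<open>cfg d V\<close> are set to 0, so the weight 1 gives the projection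
  onto \<open>l2 d V\<close> rather than \<open>id\<close>, and diagonal operators compose as total
  functions.\<close>

definition diag_op :: "nat \<Rightarrow> 'v set \<Rightarrow> (('v \<Rightarrow> int) \<Rightarrow> complex) \<Rightarrow> 'v oper" where
  "diag_op d V p \<psi> = (\<lambda>k. if k \<in> cfg d V then p k * \<psi> k else 0)"

lemma diag_op_comp: "diag_op d V p \<circ> diag_op d V q = diag_op d V (\<lambda>k. p k * q k)"
  by (auto simp: diag_op_def fun_eq_iff)

lemma diag_op_1: "\<psi> \<in> l2 d V \<Longrightarrow> diag_op d V (\<lambda>k. 1) \<psi> = \<psi>"
  by (auto simp: diag_op_def l2_def)

lemma diag_op_cong: "(\<And>k. k \<in> cfg d V \<Longrightarrow> p k = q k) \<Longrightarrow> diag_op d V p = diag_op d V q"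
  by (auto simp: diag_op_def fun_eq_iff)

lemma cfg_upd: "k \<in> cfg d V \<Longrightarrow> i \<in> V \<Longrightarrow> 0 \<le> h \<Longrightarrow> h < int d \<Longrightarrow> k(i := h) \<in> cfg d V"
  by (auto simp: cfg_def PiE_iff extensional_def)

lemma cfg_bounds: "k \<in> cfg d V \<Longrightarrow> i \<in> V \<Longrightarrow> 0 \<le> k i \<and> k i < int d"
  by (auto simp: cfg_def PiE_iff)

lemma finite_cfg: "finite V \<Longrightarrow> finite (cfg d V)"
  by (simp add: cfg_def finite_PiE)

text \<open>The weights commute, as \<open>comm_prod_insert\<close> requires. The empty product is
  \<open>id\<close>, with which the diagonal operator of weight 1 agrees only on
  \<open>l2 d V\<close>; hence the restriction on \<open>\<psi>\<close>.\<close>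

lemma comm_prod_diag_op:
  assumes "finite K" and "\<And>e. e \<in> K \<Longrightarrow> f e = diag_op d V (p e)" and "\<psi> \<in> l2 d V"
  shows "comm_prod f K \<psi> = diag_op d V (\<lambda>k. \<Prod>e\<in>K. p e k) \<psi>"
  using assms(1,2)
proof (induction K)
  case empty
  then show ?case using diag_op_1 [OF assms(3)] by (simp add: comm_prod_empty)
next
  case (insert e K)
  have "comm_prod f (insert e K) = f e \<circ> comm_prod f K"
    using insert.hyps insert.prems
    by (intro comm_prod_insert) (auto simp: diag_op_comp mult.commute)
  then show ?case
    using insert by (simp add: diag_op_comp [THEN fun_cong, simplified])
qed

section \<open>The gates in coordinates\<close>

text \<open>The definition says where each \<open>ket g\<close> goes; here the value at
  \<open>k\<close> is read off. Only those \<open>g\<close> that agree with \<open>k\<close> away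
  from \<open>i\<close> can reach \<open>k\<close>.\<close>

lemma fourier_apply:
  assumes "finite V" and "i \<in> V"
  shows "fourier d V i \<psi> k = (if k \<in> cfg d V then
    of_real (1 / sqrt d) * (\<Sum>h = 0..<int d. chi d h (k i) * \<psi> (k(i := h))) else 0)"
proof (cases "k \<in> cfg d V")
  case False
  then have "ket (g(i := h)) k = 0" if "g \<in> cfg d V" "h \<in> {0..<int d}" for g h
    using that cfg_upd [of g d V i h] assms(2) by (auto simp: ket_def)
  then show ?thesis
    using False by (simp add: fourier_def lin_ext_def)
next
  case True
  let ?A = "(\<lambda>h. k(i := h)) ` {0..<int d}"
  let ?c = "complex_of_real (1 / sqrt (real d))"
  have A: "?A \<subseteq> cfg d V"
    using True assms(2) by (auto intro: cfg_upd)
  have inner: "(\<Sum>h = 0..<int d. ?c * chi d (g i) h * ket (g(i := h)) k)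
      = (if g \<in> ?A then ?c * chi d (g i) (k i) else 0)" if g: "g \<in> cfg d V" for g
  proof -
    have "g \<in> ?A \<longleftrightarrow> k = g(i := k i)"
    proof
      assume "k = g(i := k i)"
      then have "g = k(i := g i)" by (metis fun_upd_triv fun_upd_upd)
      then show "g \<in> ?A" using cfg_bounds [OF g assms(2)] by (metis atLeastLessThan_iff imageI)
    qed auto
    \<comment> \<open>The ket is nonzero for at most one \<open>h\<close>, namely
      \<open>k i\<close>, so the inner sum collapses to a single term.\<close>
    moreover have "ket (g(i := h)) k = (if h = k i then if k = g(i := k i) then 1 else 0 else 0)" for h
      by (auto simp: ket_def dest: fun_cong [of _ _ i])
    ultimately show ?thesis
      using cfg_bounds [OF True assms(2)] by (simp add: if_distrib [of "\<lambda>x. _ * x"] cong: if_cong)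
  qed
  have *: "\<psi> g * (if b then z else 0) = (if b then \<psi> g * z else 0)" for g b z
    by simp
  have "fourier d V i \<psi> k
      = (\<Sum>g\<in>cfg d V. if g \<in> ?A then \<psi> g * (?c * chi d (g i) (k i)) else 0)"
    unfolding fourier_def lin_ext_def by (rule sum.cong) (simp_all only: inner *)
  also have "\<dots> = (\<Sum>g\<in>?A. \<psi> g * (?c * chi d (g i) (k i)))"
    using A finite_cfg [OF assms(1), of d] by (simp add: sum.inter_restrict [symmetric] Int_absorb1)
  also have "\<dots> = (\<Sum>h = 0..<int d. \<psi> (k(i := h)) * (?c * chi d h (k i)))"
    by (subst sum.reindex) (auto simp: inj_on_def dest: fun_cong [of _ _ i])
  finally show ?thesis
    using True by (simp add: sum_distrib_left ac_simps)
qed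

text \<open>Basis vectors are permuted, so a wave function is pulled back along the inverse
  permutation, whence the minus sign. As \<open>i \<noteq> j\<close>, the control entry is the same
  before and after the shift.\<close>

lemma cshift_apply:
  assumes "finite V" and "i \<in> V" and "j \<in> V" and "i \<noteq> j"
  shows "cshift d V i j n \<psi> k =
    (if k \<in> cfg d V then \<psi> (k(j := (k j - n * k i) mod int d)) else 0)"
proof (cases "k \<in> cfg d V")
  case False
  have "ket (g(j := (g j + n * g i) mod int d)) k = 0" if "g \<in> cfg d V" for g
  proof -
    have "d > 0" using cfg_bounds [OF that assms(2)] by auto
    then have "g(j := (g j + n * g i) mod int d) \<in> cfg d V"
      using that assms(3) by (simp add: cfg_upd)
    then show ?thesis using False by (auto simp: ket_def)
  qed
  then show ?thesis using False by (simp add: cshift_def lin_ext_def)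
next
  case True
  let ?g = "k(j := (k j - n * k i) mod int d)"
  have d: "d > 0" using cfg_bounds [OF True assms(2)] by auto
  have mem: "?g \<in> cfg d V" using True assms(3) d by (simp add: cfg_upd)
  have "ket (g(j := (g j + n * g i) mod int d)) k = (if g = ?g then 1 else 0)"
    if g: "g \<in> cfg d V" for g
  proof -
    have "k = g(j := (g j + n * g i) mod int d) \<longleftrightarrow> g = ?g"
    proof
      assume k: "k = g(j := (g j + n * g i) mod int d)"
      then have "k i = g i" "k j = (g j + n * g i) mod int d"
        using assms(4) by (metis fun_upd_apply)+
      then have "(k j - n * k i) mod int d = g j"
        using cfg_bounds [OF g assms(3)] by (simp add: mod_simps)
      then show "g = ?g" using k by (metis fun_upd_triv fun_upd_upd)
    next
      assume gk: "g = ?g"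
      then have "g i = k i" "g j = (k j - n * k i) mod int d"
        using assms(4) by (metis fun_upd_apply)+
      then have "(g j + n * g i) mod int d = k j"
        using cfg_bounds [OF True assms(3)] by (simp add: mod_simps)
      then show "k = g(j := (g j + n * g i) mod int d)" using gk by (metis fun_upd_triv fun_upd_upd)
    qed
    then show ?thesis by (auto simp: ket_def)
  qed
  then have "cshift d V i j n \<psi> k = (\<Sum>g\<in>cfg d V. if g = ?g then \<psi> g else 0)"
    unfolding cshift_def lin_ext_def by (intro sum.cong) auto
  then show ?thesis
    using True mem finite_cfg [OF assms(1), of d] by simp
qed

lemma fourier_l2: "finite V \<Longrightarrow> i \<in> V \<Longrightarrow> fourier d V i \<psi> \<in> l2 d V"
  by (simp add: l2_def fourier_apply)

section \<open>Commutation relations of the gates\<close>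

text \<open>Transforms at different vertices each sum over their own entry, so the two orders give
  one double sum with the summations exchanged.\<close>

lemma fourier_commute:
  assumes "finite V" and "i \<in> V" and "j \<in> V"
  shows "fourier d V i \<circ> fourier d V j = fourier d V j \<circ> fourier d V i"
proof (cases "i = j")
  case False
  show ?thesis
  proof (intro ext)
    fix \<psi> k
    let ?R = "{0..<int d}"
    let ?c = "complex_of_real (1 / sqrt (real d))"
    have double: "(fourier d V a \<circ> fourier d V b) \<psi> k = ?c * ?c *
        (\<Sum>h\<in>?R. \<Sum>h'\<in>?R. chi d h (k a) * (chi d h' (k b) * \<psi> (k(a := h, b := h'))))"
      if "k \<in> cfg d V" "a \<in> V" "b \<in> V" "a \<noteq> b" for a b
      using that assms(1) by (simp add: fourier_apply cfg_upd sum_distrib_left ac_simps)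
    show "(fourier d V i \<circ> fourier d V j) \<psi> k = (fourier d V j \<circ> fourier d V i) \<psi> k"
    proof (cases "k \<in> cfg d V")
      case True
      show ?thesis
        unfolding double [OF True assms(2,3) False] double [OF True assms(3,2) False [symmetric]]
        using False by (subst sum.swap) (simp add: fun_upd_twist ac_simps)
    qed (use assms in \<open>simp add: fourier_apply\<close>)
  qed
qed simp

text \<open>The transform sums only over changes of the entry at \<open>i\<close>, along which the
  weight is constant, so the weight factors out.\<close>

lemma fourier_diag_op_commute:
  assumes "finite V" and "i \<in> V" and "\<And>k h. k \<in> cfg d V \<Longrightarrow> p (k(i := h)) = p k"
  shows "fourier d V i \<circ> diag_op d V p = diag_op d V p \<circ> fourier d V i"
proof (intro ext)
  fix \<psi> k
  show "(fourier d V i \<circ> diag_op d V p) \<psi> k = (diag_op d V p \<circ> fourier d V i) \<psi> k"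
    using assms by (simp add: fourier_apply diag_op_def cfg_upd sum_distrib_left ac_simps)
qed

text \<open>For the Weyl shift \<open>U\<close> and clock \<open>Z\<close> this is \<open>F U F\<^sup>* = Z\<close>.\<close>

lemma fourier_cshift:
  assumes "finite V" and "i \<in> V" and "j \<in> V" and "i \<noteq> j"
  shows "fourier d V j \<circ> cshift d V i j n
    = diag_op d V (\<lambda>k. chi d (n * k i) (k j)) \<circ> fourier d V j"
proof (intro ext)
  fix \<psi> k
  show "(fourier d V j \<circ> cshift d V i j n) \<psi> k
    = (diag_op d V (\<lambda>k. chi d (n * k i) (k j)) \<circ> fourier d V j) \<psi> k"
  proof (cases "k \<in> cfg d V")
    case True
    have d: "d > 0" using cfg_bounds [OF True assms(2)] by auto
    \<comment> \<open>Translating the summation variable by \<open>n * k i\<close> undoes the shift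
      inside \<open>\<psi>\<close> and moves it into the character.\<close>
    have "(\<Sum>h = 0..<int d. chi d h (k j) * \<psi> (k(j := (h - n * k i) mod int d)))
      = (\<Sum>h = 0..<int d. chi d ((h + n * k i) mod int d) (k j) *
          \<psi> (k(j := ((h + n * k i) mod int d - n * k i) mod int d)))"
      by (rule sum.reindex_bij_betw [OF bij_betw_add_mod [OF d], symmetric])
    also have "\<dots> = (\<Sum>h = 0..<int d. chi d (n * k i) (k j) * (chi d h (k j) * \<psi> (k(j := h))))"
      using d by (intro sum.cong) (simp_all add: chi_mod_left chi_add_left mod_simps)
    finally show ?thesis
      using True assms
      by (simp add: fourier_apply cshift_apply diag_op_def cfg_upd sum_distrib_left [symmetric])
  qed (use assms in \<open>simp add: fourier_apply diag_op_def\<close>)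
qed

text \<open>Here \<open>F Z F\<^sup>* = U\<^sup>*\<close>, whence the sign.\<close>

lemma fourier_diag_op:
  assumes "finite V" and "i \<in> V" and "j \<in> V" and "i \<noteq> j"
  shows "fourier d V j \<circ> diag_op d V (\<lambda>k. chi d (n * k i) (k j))
    = cshift d V i j (- n) \<circ> fourier d V j"
proof (intro ext)
  fix \<psi> k
  show "(fourier d V j \<circ> diag_op d V (\<lambda>k. chi d (n * k i) (k j))) \<psi> k
    = (cshift d V i j (- n) \<circ> fourier d V j) \<psi> k"
  proof (cases "k \<in> cfg d V")
    case True
    have d: "d > 0" using cfg_bounds [OF True assms(2)] by auto
    \<comment> \<open>The phase is absorbed into the Fourier kernel as a translation of the output
      entry \<open>k j\<close> by \<open>n * k i\<close>.\<close>
    have "chi d h ((k j + n * k i) mod int d) = chi d h (k j) * chi d (n * k i) h" for h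
      using d by (simp add: chi_commute [of d h] chi_mod_left chi_add_left)
    then show ?thesis
      using True assms d
      by (simp add: fourier_apply cshift_apply diag_op_def cfg_upd ac_simps)
  qed (use assms in \<open>simp add: fourier_apply cshift_apply\<close>)
qed

section \<open>The adjoint of a local transform and the controlled phase\<close>

text \<open>The Fourier kernel is symmetric, so taking the adjoint amounts to conjugating the
  kernel, which negates one argument of \<open>chi\<close>.\<close>

lemma adj_fourier_apply:
  assumes "finite V" and "i \<in> V"
  shows "adj d V V (fourier d V i) \<psi> k = (if k \<in> cfg d V then
    of_real (1 / sqrt d) * (\<Sum>h = 0..<int d. chi d (- k i) h * \<psi> (k(i := h))) else 0)"
proof (cases "k \<in> cfg d V")
  case True
  let ?A = "(\<lambda>h. k(i := h)) ` {0..<int d}"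
  let ?c = "complex_of_real (1 / sqrt (real d))"
  have A: "?A \<subseteq> cfg d V"
    using True assms(2) by (auto intro: cfg_upd)
  have F: "fourier d V i (ket k) g = (if g \<in> ?A then ?c * chi d (k i) (g i) else 0)"
    if g: "g \<in> cfg d V" for g
  proof -
    have "g \<in> ?A \<longleftrightarrow> g(i := k i) = k"
    proof
      assume "g(i := k i) = k"
      then have "g = k(i := g i)" by (metis fun_upd_triv fun_upd_upd)
      then show "g \<in> ?A" using cfg_bounds [OF g assms(2)] by (metis atLeastLessThan_iff imageI)
    qed auto
    moreover have "ket k (g(i := h)) = (if h = k i then if g(i := k i) = k then 1 else 0 else 0)" for h
      by (auto simp: ket_def dest: fun_cong [of _ _ i])
    ultimately show ?thesis
      using g cfg_bounds [OF True assms(2)] assms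
      by (simp add: fourier_apply if_distrib [of "\<lambda>x. _ * x"] cong: if_cong)
  qed
  have "adj d V V (fourier d V i) \<psi> k
      = (\<Sum>g\<in>cfg d V. if g \<in> ?A then ?c * chi d (- k i) (g i) * \<psi> g else 0)"
    using True by (simp add: adj_def inner_prod_def) (rule sum.cong, auto simp: F cnj_chi)
  also have "\<dots> = (\<Sum>g\<in>?A. ?c * chi d (- k i) (g i) * \<psi> g)"
    using A finite_cfg [OF assms(1), of d] by (simp add: sum.inter_restrict [symmetric] Int_absorb1)
  also have "\<dots> = (\<Sum>h = 0..<int d. ?c * chi d (- k i) h * \<psi> (k(i := h)))"
    by (subst sum.reindex) (auto simp: inj_on_def dest: fun_cong [of _ _ i])
  finally show ?thesis
    using True by (simp add: sum_distrib_left ac_simps)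
qed (simp add: adj_def)

text \<open>Composing the kernels leaves, for each \<open>h'\<close>, the full character sum at
  \<open>k i - h'\<close>, which \<open>sum_chi\<close> evaluates. The composition vanishes off
  \<open>cfg d V\<close>, so it is the projection and not \<open>id\<close>.\<close>

lemma fourier_adj_fourier:
  assumes "finite V" and "i \<in> V"
  shows "fourier d V i \<circ> adj d V V (fourier d V i) = diag_op d V (\<lambda>k. 1)"
proof (intro ext)
  fix \<psi> k
  let ?R = "{0..<int d}"
  let ?c = "complex_of_real (1 / sqrt (real d))"
  show "(fourier d V i \<circ> adj d V V (fourier d V i)) \<psi> k = diag_op d V (\<lambda>k. 1) \<psi> k"
  proof (cases "k \<in> cfg d V")
    case True
    have ki: "0 \<le> k i" "k i < int d" and d: "d > 0"
      using cfg_bounds [OF True assms(2)] by auto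
    \<comment> \<open>Both entries lie between 0 and \<open>d - 1\<close>, so congruence modulo
      \<open>d\<close> forces equality.\<close>
    have dvd: "int d dvd k i - h \<longleftrightarrow> h = k i" if "h \<in> ?R" for h
      using that ki by (auto simp: mod_eq_dvd_iff [symmetric])
    have "(fourier d V i \<circ> adj d V V (fourier d V i)) \<psi> k
        = ?c * ?c * (\<Sum>h\<in>?R. \<Sum>h'\<in>?R. chi d h (k i) * (chi d (- h) h' * \<psi> (k(i := h'))))"
      using True assms by (simp add: fourier_apply adj_fourier_apply cfg_upd sum_distrib_left ac_simps)
    also have "\<dots> = ?c * ?c * (\<Sum>h'\<in>?R. \<Sum>h\<in>?R. chi d h (k i) * (chi d (- h) h' * \<psi> (k(i := h'))))"
      by (subst sum.swap) simp
    also have "\<dots> = ?c * ?c * (\<Sum>h'\<in>?R. (\<Sum>h\<in>?R. chi d h (k i - h')) * \<psi> (k(i := h')))"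
    proof -
      have "chi d h (k i) * chi d (- h) h' = chi d h (k i - h')" for h h'
        by (simp add: chi_def exp_add [symmetric] algebra_simps)
      then show ?thesis by (simp add: sum_distrib_right mult.assoc [symmetric])
    qed
    also have "\<dots> = ?c * ?c * (\<Sum>h'\<in>?R. if h' = k i then of_nat d * \<psi> k else 0)"
      using d dvd by (intro arg_cong [of _ _ "\<lambda>x. ?c * ?c * x"] sum.cong) (auto simp: sum_chi)
    also have "\<dots> = \<psi> k"
    proof -
      have "?c * ?c * of_nat d = of_real (1 / sqrt (real d) * (1 / sqrt (real d)) * real d)"
        by (simp only: of_real_mult of_real_of_nat_eq)
      also have "\<dots> = 1" using d by simp
      finally show ?thesis using ki by (simp add: mult.assoc [symmetric])
    qed
    finally show ?thesis using True by (simp add: diag_op_def)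
  qed (use assms in \<open>simp add: fourier_apply diag_op_def\<close>)
qed

text \<open>By \<open>fourier_cshift\<close> the shift passes the left transform and becomes a
  phase; what remains is the transform times its adjoint, which the diagonal operator
  absorbs.\<close>

lemma cphase_eq_diag_op:
  assumes "finite V" and "i \<in> V" and "j \<in> V" and "i \<noteq> j"
  shows "cphase d V i j n = diag_op d V (\<lambda>k. chi d (n * k i) (k j))"
  using fourier_cshift [OF assms] fourier_adj_fourier [OF assms(1,3)]
  by (simp add: cphase_def comp_assoc diag_op_comp)

section \<open>Products of transforms and their adjoints\<close>

text \<open>\<open>adj\<close> is given by coordinates; the adjoint relation for general vectors
  follows by exchanging two finite sums. Both sides read \<open>\<phi>\<close> and
  \<open>\<psi>\<close> only on \<open>cfg d V\<close>.\<close>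

lemma inner_prod_lin_ext:
  assumes "finite V"
  shows "inner_prod d V (lin_ext d V f \<phi>) \<psi> = inner_prod d V \<phi> (adj d V V (lin_ext d V f) \<psi>)"
proof -
  have "lin_ext d V f (ket g) = f g" if "g \<in> cfg d V" for g
    using that finite_cfg [OF assms, of d]
    by (simp add: lin_ext_def ket_def if_distrib [of "\<lambda>x. x * _"] cong: if_cong)
  then have "inner_prod d V \<phi> (adj d V V (lin_ext d V f) \<psi>)
      = (\<Sum>g\<in>cfg d V. \<Sum>k\<in>cfg d V. cnj (\<phi> g) * (cnj (f g k) * \<psi> k))"
    by (simp add: inner_prod_def adj_def sum_distrib_left)
  also have "\<dots> = (\<Sum>k\<in>cfg d V. \<Sum>g\<in>cfg d V. cnj (\<phi> g) * (cnj (f g k) * \<psi> k))"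
    by (rule sum.swap)
  also have "\<dots> = inner_prod d V (lin_ext d V f \<phi>) \<psi>"
    by (simp add: inner_prod_def lin_ext_def sum_distrib_right mult.assoc)
  finally show ?thesis by simp
qed

lemma inner_prod_fourier:
  assumes "finite V"
  shows "inner_prod d V (fourier d V i \<phi>) \<psi> = inner_prod d V \<phi> (adj d V V (fourier d V i) \<psi>)"
  unfolding fourier_def by (rule inner_prod_lin_ext [OF assms])

lemma fourier_set_insert:
  assumes "finite V" and "insert i A \<subseteq> V" and "i \<notin> A"
  shows "fourier_set d V (insert i A) = fourier d V i \<circ> fourier_set d V A"
  unfolding fourier_set_def
  using assms by (intro comm_prod_insert) (auto simp: finite_subset intro!: fourier_commute)

lemma fourier_set_empty [simp]: "fourier_set d V {} = id"
  by (simp add: fourier_set_def comm_prod_empty)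

lemma fourier_set_Un:
  assumes "finite V" and "A \<union> B \<subseteq> V" and "A \<inter> B = {}"
  shows "fourier_set d V (A \<union> B) = fourier_set d V A \<circ> fourier_set d V B"
proof -
  have "finite A" using assms by (meson finite_subset le_sup_iff)
  then show ?thesis using assms(2,3)
  proof (induction A)
    case (insert i A)
    then show ?case using assms(1) by (simp add: fourier_set_insert comp_assoc)
  qed simp
qed

lemma fourier_set_diag_op_commute:
  assumes "finite V" and "A \<subseteq> V"
    and "\<And>i k h. i \<in> A \<Longrightarrow> k \<in> cfg d V \<Longrightarrow> p (k(i := h)) = p k"
  shows "fourier_set d V A \<circ> diag_op d V p = diag_op d V p \<circ> fourier_set d V A"
  using finite_subset [OF assms(2,1)] assms(2,3)
proof (induction A)
  case (insert i A)
  then have F: "fourier_set d V (insert i A) = fourier d V i \<circ> fourier_set d V A"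
    and c: "fourier d V i \<circ> diag_op d V p = diag_op d V p \<circ> fourier d V i"
    and IH: "fourier_set d V A \<circ> diag_op d V p = diag_op d V p \<circ> fourier_set d V A"
    using assms(1) fourier_set_insert [of V i A d] fourier_diag_op_commute [of V i d p] by blast+
  show ?case
    by (simp only: F comp_assoc IH) (simp only: comp_assoc [symmetric] c)
qed simp

text \<open>\<open>S\<close> is the product of the single adjoints in reverse order. The existential
  form carries the adjoint relation and the inverse property through the induction together, without
  naming that order.\<close>

lemma fourier_set_right_inverse:
  assumes "finite V" and "A \<subseteq> V"
  shows "\<exists>S. (\<forall>\<phi> \<psi>. inner_prod d V (fourier_set d V A \<phi>) \<psi> = inner_prod d V \<phi> (S \<psi>)) \<and>
    (\<forall>\<psi>\<in>l2 d V. S \<psi> \<in> l2 d V \<and> fourier_set d V A (S \<psi>) = \<psi>)"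
  using finite_subset [OF assms(2,1)] assms(2)
proof (induction A)
  case empty
  show ?case by (rule exI [of _ id]) simp
next
  case (insert i A)
  then obtain S where S: "\<And>\<phi> \<psi>. inner_prod d V (fourier_set d V A \<phi>) \<psi> = inner_prod d V \<phi> (S \<psi>)"
    "\<And>\<psi>. \<psi> \<in> l2 d V \<Longrightarrow> S \<psi> \<in> l2 d V \<and> fourier_set d V A (S \<psi>) = \<psi>"
    by auto
  let ?F = "adj d V V (fourier d V i)"
  have i: "i \<in> V" using insert by simp
  have "?F \<psi> \<in> l2 d V" for \<psi> by (simp add: adj_def l2_def)
  moreover have "fourier d V i (?F \<psi>) = \<psi>" if "\<psi> \<in> l2 d V" for \<psi>
    using fourier_adj_fourier [OF assms(1) i, THEN fun_cong, of d \<psi>] diag_op_1 [OF that] by simp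
  \<comment> \<open>The new factor stands on the left of the product, so its adjoint is applied
    first: the witness is \<open>S \<circ> ?F\<close>.\<close>
  ultimately show ?case
    using S insert assms(1) i
    by (intro exI [of _ "S \<circ> ?F"]) (simp add: fourier_set_insert inner_prod_fourier)
qed

lemma fourier_set_adj:
  assumes "finite V" and "A \<subseteq> V" and "\<psi> \<in> l2 d V"
  shows "fourier_set d V A (adj d V V (fourier_set d V A) \<psi>) = \<psi>"
proof -
  obtain S where S: "\<And>\<phi> \<psi>. inner_prod d V (fourier_set d V A \<phi>) \<psi> = inner_prod d V \<phi> (S \<psi>)"
    "\<And>\<psi>. \<psi> \<in> l2 d V \<Longrightarrow> S \<psi> \<in> l2 d V \<and> fourier_set d V A (S \<psi>) = \<psi>"
    using fourier_set_right_inverse [OF assms(1,2)] by blast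
  \<comment> \<open>Each coordinate equals the inner product of \<open>ket g\<close> with
    \<open>S \<psi>\<close>, that is, a coordinate of the adjoint of \<open>id\<close>; thus
    \<open>adj_id\<close> identifies the adjoint with \<open>S\<close>.\<close>
  have "adj d V V (fourier_set d V A) \<psi> = adj d V V id (S \<psi>)"
    by (simp add: adj_def S(1) cong: if_cong)
  then show ?thesis
    using S(2) [OF assms(3)] adj_id [OF assms(1)] by simp
qed

section \<open>Phases of stars and subgraphs, and the gates for one star\<close>

lemma foldr_comp_append: "foldr (\<circ>) (as @ bs) id = foldr (\<circ>) as id \<circ> foldr (\<circ>) bs id"
  by (induction as) (simp_all add: comp_assoc)

definition nbrs :: "('v \<Rightarrow> 'v \<Rightarrow> int) \<Rightarrow> 'v \<Rightarrow> 'v set \<Rightarrow> 'v set" where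
  "nbrs \<Gamma> m A = {i \<in> A. \<Gamma> i m \<noteq> 0}"

text \<open>The phase of the star with centre \<open>m\<close> and leaves \<open>W\<close>. The
  centre is the second argument of \<open>chi\<close>, matching the target of the shift in
  \<open>fourier_cshift\<close> and \<open>fourier_diag_op\<close>.\<close>

definition fan_phase :: "nat \<Rightarrow> ('v \<Rightarrow> 'v \<Rightarrow> int) \<Rightarrow> 'v \<Rightarrow> 'v set \<Rightarrow> ('v \<Rightarrow> int) \<Rightarrow> complex" where
  "fan_phase d \<Gamma> m W k = (\<Prod>i\<in>W. chi d (\<Gamma> i m * k i) (k m))"

definition edge_phase :: "nat \<Rightarrow> ('v \<Rightarrow> 'v \<Rightarrow> int) \<Rightarrow> ('v \<Rightarrow> int) \<Rightarrow> 'v set \<Rightarrow> complex" where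
  "edge_phase d \<Gamma> k = on_pair (\<lambda>i j. chi d (\<Gamma> i j * k i) (k j))"

text \<open>The cluster state wave function of the subgraph on \<open>A\<close>, without its
  normalisation. The product runs over edges only, so that each factor accounts for one
  gate.\<close>

definition graph_phase :: "nat \<Rightarrow> ('v \<Rightarrow> 'v \<Rightarrow> int) \<Rightarrow> 'v set \<Rightarrow> ('v \<Rightarrow> int) \<Rightarrow> complex" where
  "graph_phase d \<Gamma> A k = (\<Prod>e\<in>edges A \<Gamma>. edge_phase d \<Gamma> k e)"

lemma fan_phase_insert:
  assumes "finite W" and "i \<notin> W"
  shows "diag_op d V (fan_phase d \<Gamma> m (insert i W))
    = diag_op d V (\<lambda>k. chi d (\<Gamma> i m * k i) (k m)) \<circ> diag_op d V (fan_phase d \<Gamma> m W)"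
  unfolding diag_op_comp using assms by (intro diag_op_cong) (simp add: fan_phase_def)

lemma cshift_mem_elementary_gates:
  "i \<in> V \<Longrightarrow> j \<in> V \<Longrightarrow> i \<noteq> j \<Longrightarrow> cshift d V i j n \<in> elementary_gates d V"
  by (auto simp: elementary_gates_def)

lemma fourier_mem_elementary_gates: "i \<in> V \<Longrightarrow> fourier d V i \<in> elementary_gates d V"
  by (auto simp: elementary_gates_def)

text \<open>By \<open>fourier_cshift\<close>, moving one factor of the star phase to the right of
  \<open>fourier d V m\<close> turns it into one shift with target \<open>m\<close>. The transform
  survives, so each leaf costs one gate.\<close>

lemma fan_phase_fourier_gates:
  assumes "finite V" and "m \<in> V" and "W \<subseteq> V" and "m \<notin> W"
  shows "\<exists>cs. length cs = card W \<and> set cs \<subseteq> elementary_gates d V \<and>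
    diag_op d V (fan_phase d \<Gamma> m W) \<circ> fourier d V m = fourier d V m \<circ> foldr (\<circ>) cs id"
  using finite_subset [OF assms(3,1)] assms(3,4)
proof (induction W)
  case empty
  \<comment> \<open>The empty star phase is the projection onto \<open>l2 d V\<close>; it is
    absorbed because the transform already vanishes off \<open>cfg d V\<close>.\<close>
  have "diag_op d V (fan_phase d \<Gamma> m {}) \<circ> fourier d V m = fourier d V m"
    using assms(1,2) by (auto simp: fun_eq_iff fan_phase_def diag_op_def fourier_apply)
  then show ?case by (intro exI [of _ "[]"]) simp
next
  case (insert i W)
  have i: "i \<in> V" "i \<noteq> m" using insert.prems by auto
  obtain cs where cs: "length cs = card W" "set cs \<subseteq> elementary_gates d V"
    "diag_op d V (fan_phase d \<Gamma> m W) \<circ> fourier d V m = fourier d V m \<circ> foldr (\<circ>) cs id"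
    using insert.IH insert.prems by blast
  have "diag_op d V (fan_phase d \<Gamma> m (insert i W)) \<circ> fourier d V m
      = diag_op d V (\<lambda>k. chi d (\<Gamma> i m * k i) (k m)) \<circ> fourier d V m \<circ> foldr (\<circ>) cs id"
    by (simp only: fan_phase_insert [OF insert.hyps] comp_assoc cs(3))
  also have "\<dots> = fourier d V m \<circ> foldr (\<circ>) (cshift d V i m (\<Gamma> i m) # cs) id"
    by (simp only: fourier_cshift [OF assms(1) i(1) assms(2) i(2), symmetric] comp_assoc
        foldr.simps comp_apply)
  finally have eq: "diag_op d V (fan_phase d \<Gamma> m (insert i W)) \<circ> fourier d V m
      = fourier d V m \<circ> foldr (\<circ>) (cshift d V i m (\<Gamma> i m) # cs) id" .
  have len: "length (cshift d V i m (\<Gamma> i m) # cs) = card (insert i W)"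
    and mem: "set (cshift d V i m (\<Gamma> i m) # cs) \<subseteq> elementary_gates d V"
    using cs(1,2) insert.hyps cshift_mem_elementary_gates [OF i(1) assms(2) i(2)] by simp_all
  show ?case
    by (intro exI [of _ "cshift d V i m (\<Gamma> i m) # cs"] conjI len mem eq)
qed

text \<open>The mirror image, with the transform to the left of the star phase. By
  \<open>fourier_diag_op\<close> the shifts come out on the left, with negated weights.\<close>

lemma fourier_fan_phase_gates:
  assumes "finite V" and "m \<in> V" and "W \<subseteq> V" and "m \<notin> W"
  shows "\<exists>cs. length cs = card W \<and> set cs \<subseteq> elementary_gates d V \<and>
    fourier d V m \<circ> diag_op d V (fan_phase d \<Gamma> m W) = foldr (\<circ>) cs id \<circ> fourier d V m"
  using finite_subset [OF assms(3,1)] assms(3,4)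
proof (induction W)
  case empty
  \<comment> \<open>Here the projection is absorbed because the transform reads its argument only on
    \<open>cfg d V\<close>.\<close>
  have "fourier d V m \<circ> diag_op d V (fan_phase d \<Gamma> m {}) = fourier d V m"
    using assms(1,2) by (auto simp: fun_eq_iff fan_phase_def diag_op_def fourier_apply cfg_upd)
  then show ?case by (intro exI [of _ "[]"]) simp
next
  case (insert i W)
  have i: "i \<in> V" "i \<noteq> m" using insert.prems by auto
  obtain cs where cs: "length cs = card W" "set cs \<subseteq> elementary_gates d V"
    "fourier d V m \<circ> diag_op d V (fan_phase d \<Gamma> m W) = foldr (\<circ>) cs id \<circ> fourier d V m"
    using insert.IH insert.prems by blast
  have "fourier d V m \<circ> diag_op d V (fan_phase d \<Gamma> m (insert i W))
      = cshift d V i m (- \<Gamma> i m) \<circ> fourier d V m \<circ> diag_op d V (fan_phase d \<Gamma> m W)"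
    by (simp only: fan_phase_insert [OF insert.hyps] comp_assoc [symmetric]
        fourier_diag_op [OF assms(1) i(1) assms(2) i(2)])
  also have "\<dots> = foldr (\<circ>) (cshift d V i m (- \<Gamma> i m) # cs) id \<circ> fourier d V m"
    by (simp only: comp_assoc cs(3) foldr.simps comp_apply)
  finally have eq: "fourier d V m \<circ> diag_op d V (fan_phase d \<Gamma> m (insert i W))
      = foldr (\<circ>) (cshift d V i m (- \<Gamma> i m) # cs) id \<circ> fourier d V m" .
  have len: "length (cshift d V i m (- \<Gamma> i m) # cs) = card (insert i W)"
    and mem: "set (cshift d V i m (- \<Gamma> i m) # cs) \<subseteq> elementary_gates d V"
    using cs(1,2) insert.hyps cshift_mem_elementary_gates [OF i(1) assms(2) i(2)] by simp_all
  show ?case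
    by (intro exI [of _ "cshift d V i m (- \<Gamma> i m) # cs"] conjI len mem eq)
qed

section \<open>Edges and phases when a vertex is added\<close>

lemma finite_edges: "finite A \<Longrightarrow> finite (edges A \<Gamma>)"
  by (rule finite_subset [of _ "Pow A"]) (auto simp: edges_def)

text \<open>The edges at the new vertex correspond bijectively to its neighbours. Disjointness and
  injectivity serve both the gate count and the product of phases.\<close>

lemma edges_insert:
  assumes "weighted_graph V \<Gamma>" and "insert m A \<subseteq> V" and "m \<notin> A"
  shows "edges (insert m A) \<Gamma> = edges A \<Gamma> \<union> (\<lambda>i. {i, m}) ` nbrs \<Gamma> m A"
    and "edges A \<Gamma> \<inter> (\<lambda>i. {i, m}) ` nbrs \<Gamma> m A = {}"
    and "inj_on (\<lambda>i. {i, m}) (nbrs \<Gamma> m A)"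
proof -
  have sym: "\<Gamma> i m = \<Gamma> m i" if "i \<in> A" for i
    using that assms by (auto simp: weighted_graph_def)
  show "edges (insert m A) \<Gamma> = edges A \<Gamma> \<union> (\<lambda>i. {i, m}) ` nbrs \<Gamma> m A"
  proof (rule equalityI; rule subsetI)
    fix e assume "e \<in> edges (insert m A) \<Gamma>"
    then obtain i j where "e = {i, j}" "i \<in> insert m A" "j \<in> insert m A" "i \<noteq> j" "\<Gamma> i j \<noteq> 0"
      by (auto simp: edges_def)
    then show "e \<in> edges A \<Gamma> \<union> (\<lambda>i. {i, m}) ` nbrs \<Gamma> m A"
      using sym by (auto simp: edges_def nbrs_def image_iff insert_commute)
  next
    fix e assume "e \<in> edges A \<Gamma> \<union> (\<lambda>i. {i, m}) ` nbrs \<Gamma> m A"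
    then show "e \<in> edges (insert m A) \<Gamma>"
      using assms(3) by (auto simp: edges_def nbrs_def)
  qed
  show "edges A \<Gamma> \<inter> (\<lambda>i. {i, m}) ` nbrs \<Gamma> m A = {}"
    using assms(3) by (auto simp: edges_def doubleton_eq_iff)
  show "inj_on (\<lambda>i. {i, m}) (nbrs \<Gamma> m A)"
    by (auto simp: inj_on_def doubleton_eq_iff)
qed

text \<open>\<open>on_pair\<close> may be evaluated in either orientation because the weight is
  symmetric and \<open>chi_mult_left\<close> exchanges the entries.\<close>

lemma edge_phase_eq:
  assumes "weighted_graph V \<Gamma>" and "i \<in> V" and "j \<in> V" and "i \<noteq> j"
  shows "edge_phase d \<Gamma> k {i, j} = chi d (\<Gamma> i j * k i) (k j)"
  unfolding edge_phase_def using assms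
  by (intro on_pair_eq) (auto simp: weighted_graph_def chi_mult_left)

lemma card_edges_insert:
  assumes "weighted_graph V \<Gamma>" and "insert m A \<subseteq> V" and "m \<notin> A"
  shows "card (edges (insert m A) \<Gamma>) = card (edges A \<Gamma>) + card (nbrs \<Gamma> m A)"
proof -
  have "finite A" using assms by (auto simp: weighted_graph_def finite_subset)
  then show ?thesis
    using edges_insert [OF assms]
    by (simp add: card_Un_disjoint finite_edges card_image nbrs_def)
qed

lemma graph_phase_insert:
  assumes "weighted_graph V \<Gamma>" and "insert m A \<subseteq> V" and "m \<notin> A"
  shows "graph_phase d \<Gamma> (insert m A) k = graph_phase d \<Gamma> A k * fan_phase d \<Gamma> m (nbrs \<Gamma> m A) k"
proof -
  have A: "finite A" using assms by (auto simp: weighted_graph_def finite_subset)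
  have "(\<Prod>i\<in>nbrs \<Gamma> m A. edge_phase d \<Gamma> k {i, m}) = fan_phase d \<Gamma> m (nbrs \<Gamma> m A) k"
    unfolding fan_phase_def using assms
    by (intro prod.cong) (auto simp: nbrs_def intro!: edge_phase_eq [OF assms(1)])
  then show ?thesis
    using A edges_insert [OF assms]
    by (simp add: graph_phase_def prod.union_disjoint finite_edges prod.reindex nbrs_def)
qed

text \<open>No edge inside \<open>A\<close> touches \<open>m\<close>. This lets
  \<open>fourier d V m\<close> pass the phases of earlier vertices.\<close>

lemma graph_phase_upd:
  assumes "weighted_graph V \<Gamma>" and "A \<subseteq> V" and "m \<notin> A"
  shows "graph_phase d \<Gamma> A (k(m := h)) = graph_phase d \<Gamma> A k"
  unfolding graph_phase_def
proof (rule prod.cong)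
  fix e assume "e \<in> edges A \<Gamma>"
  then obtain i j where e: "e = {i, j}" "i \<in> A" "j \<in> A" "i \<noteq> j"
    by (auto simp: edges_def)
  then have "i \<in> V" "j \<in> V" "i \<noteq> m" "j \<noteq> m"
    using assms(2,3) by auto
  then show "edge_phase d \<Gamma> (k(m := h)) e = edge_phase d \<Gamma> k e"
    using e by (simp add: edge_phase_eq [OF assms(1)])
qed simp

section \<open>The cluster operator in diagonal form\<close>

lemma cluster_op_apply:
  assumes "weighted_graph V \<Gamma>" and "fourier_set d V V \<psi> \<in> l2 d V"
  shows "cluster_op d V \<Gamma> \<psi> = diag_op d V (graph_phase d \<Gamma> V) (fourier_set d V V \<psi>)"
proof -
  have V: "finite V" using assms by (simp add: weighted_graph_def)
  have "two_subsets V \<subseteq> Pow V" by (auto simp: two_subsets_def)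
  then have fin: "finite (two_subsets V)" using V by (simp add: finite_subset)
  have "on_pair (\<lambda>i j. cphase d V i j (\<Gamma> i j)) e = diag_op d V (\<lambda>k. edge_phase d \<Gamma> k e)"
    if mem: "e \<in> two_subsets V" for e
  proof -
    obtain i j where e: "e = {i, j}" "i \<noteq> j" "i \<in> V" "j \<in> V"
      using mem unfolding two_subsets_def card_2_iff by blast
    then have sym: "\<Gamma> i j = \<Gamma> j i" using assms by (simp add: weighted_graph_def)
    \<comment> \<open>Both orientations give the same diagonal operator, so the choice in
      \<open>on_pair\<close> does not matter.\<close>
    have "on_pair (\<lambda>i j. cphase d V i j (\<Gamma> i j)) {i, j} = cphase d V i j (\<Gamma> i j)"
      using e V sym by (intro on_pair_eq) (simp_all add: cphase_eq_diag_op chi_mult_left)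
    then show ?thesis
      using e V by (simp add: cphase_eq_diag_op edge_phase_eq [OF assms(1)])
  qed
  then have "cluster_op d V \<Gamma> \<psi>
      = diag_op d V (\<lambda>k. \<Prod>e\<in>two_subsets V. edge_phase d \<Gamma> k e) (fourier_set d V V \<psi>)"
    unfolding cluster_op_def comp_def using fin assms(2) by (intro comm_prod_diag_op)
  \<comment> \<open>Pairs of weight 0 contribute the phase 1, so only the edges remain.\<close>
  moreover have "(\<Prod>e\<in>two_subsets V. edge_phase d \<Gamma> k e) = graph_phase d \<Gamma> V k" for k
    unfolding graph_phase_def
  proof (rule prod.mono_neutral_right [OF fin])
    show "edges V \<Gamma> \<subseteq> two_subsets V"
      by (auto simp: edges_def two_subsets_def)
    show "\<forall>e\<in>two_subsets V - edges V \<Gamma>. edge_phase d \<Gamma> k e = 1"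
    proof
      fix e assume e: "e \<in> two_subsets V - edges V \<Gamma>"
      then obtain i j where ij: "e = {i, j}" "i \<noteq> j" "i \<in> V" "j \<in> V"
        unfolding two_subsets_def card_2_iff by blast
      then have "\<Gamma> i j = 0" using e by (auto simp: edges_def)
      then show "edge_phase d \<Gamma> k e = 1"
        using ij by (simp add: edge_phase_eq [OF assms(1)])
    qed
  qed
  ultimately show ?thesis by simp
qed

section \<open>Building the circuit vertex by vertex\<close>

text \<open>Induction over the outputs: a new vertex adds its transform and one shift for each edge
  to the vertices already present, which is exactly the growth of the gate count.\<close>

lemma output_circuit:
  assumes "weighted_graph V \<Gamma>" and "Y \<subseteq> V"
  shows "\<exists>gates. length gates = card Y + card (edges Y \<Gamma>) \<and> set gates \<subseteq> elementary_gates d V \<and>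
    (\<forall>\<psi>\<in>l2 d V. diag_op d V (graph_phase d \<Gamma> Y) (fourier_set d V Y \<psi>) = foldr (\<circ>) gates id \<psi>)"
proof -
  have V: "finite V" using assms by (simp add: weighted_graph_def)
  show ?thesis
    using finite_subset [OF assms(2) V] assms(2)
  proof (induction Y)
    case empty
    have "edges {} \<Gamma> = {}" by (simp add: edges_def)
    moreover have "graph_phase d \<Gamma> {} = (\<lambda>k. 1)"
      by (simp add: graph_phase_def fun_eq_iff edges_def)
    ultimately show ?case by (intro exI [of _ "[]"]) (simp add: diag_op_1)
  next
    case (insert m Y)
    let ?W = "nbrs \<Gamma> m Y" and ?DY = "diag_op d V (graph_phase d \<Gamma> Y)"
    let ?DW = "diag_op d V (fan_phase d \<Gamma> m ?W)"
    obtain gs where gs: "length gs = card Y + card (edges Y \<Gamma>)" "set gs \<subseteq> elementary_gates d V"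
      "\<And>\<psi>. \<psi> \<in> l2 d V \<Longrightarrow> ?DY (fourier_set d V Y \<psi>) = foldr (\<circ>) gs id \<psi>"
      using insert.IH insert.prems by blast
    have m: "m \<in> V" "?W \<subseteq> V" "m \<notin> ?W" using insert.prems insert.hyps by (auto simp: nbrs_def)
    obtain cs where cs: "length cs = card ?W" "set cs \<subseteq> elementary_gates d V"
      "?DW \<circ> fourier d V m = fourier d V m \<circ> foldr (\<circ>) cs id"
      using fan_phase_fourier_gates [OF V m] by blast
    have D: "diag_op d V (graph_phase d \<Gamma> (insert m Y)) = ?DW \<circ> ?DY"
      unfolding diag_op_comp
      by (intro diag_op_cong)
        (simp add: graph_phase_insert [OF assms(1) insert.prems insert.hyps(2)] mult.commute)
    \<comment> \<open>As \<open>m \<notin> Y\<close>, the old phases do not read the entry at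
      \<open>m\<close>; the new transform can thus be moved left until it meets
      \<open>?DW\<close>.\<close>
    have "fourier d V m \<circ> ?DY = ?DY \<circ> fourier d V m"
      using insert.hyps insert.prems
      by (intro fourier_diag_op_commute V m graph_phase_upd [OF assms(1)]) simp_all
    then have "fourier d V m \<circ> (?DY \<circ> g) = ?DY \<circ> (fourier d V m \<circ> g)" for g :: "'a oper"
      by (simp only: comp_assoc [symmetric])
    then have E: "diag_op d V (graph_phase d \<Gamma> (insert m Y)) \<circ> fourier_set d V (insert m Y)
        = ?DW \<circ> fourier d V m \<circ> (?DY \<circ> fourier_set d V Y)"
      by (simp only: D fourier_set_insert [OF V insert.prems insert.hyps(2)] comp_assoc)
    have eq: "diag_op d V (graph_phase d \<Gamma> (insert m Y)) (fourier_set d V (insert m Y) \<psi>)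
        = foldr (\<circ>) (fourier d V m # cs @ gs) id \<psi>" if "\<psi> \<in> l2 d V" for \<psi>
      using gs(3) [OF that] fun_cong [OF E [unfolded cs(3)], of \<psi>]
      by (simp add: foldr_comp_append del: foldr_append)
    have len: "length (fourier d V m # cs @ gs) = card (insert m Y) + card (edges (insert m Y) \<Gamma>)"
      and mem: "set (fourier d V m # cs @ gs) \<subseteq> elementary_gates d V"
      using gs(1,2) cs(1,2) insert.hyps card_edges_insert [OF assms(1) insert.prems insert.hyps(2)]
        fourier_mem_elementary_gates [OF m(1)] by simp_all
    show ?case
      by (intro exI [of _ "fourier d V m # cs @ gs"] conjI ballI len mem eq)
  qed
qed

text \<open>Induction over the inputs, started from the circuit for the outputs. The transform at a
  new input stands leftmost, so its star phase is moved left past the transforms of the other inputs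
  to meet it.\<close>

lemma input_output_circuit:
  assumes "weighted_graph V \<Gamma>" and "X \<union> Y \<subseteq> V" and "X \<inter> Y = {}"
    and "\<forall>i\<in>X. \<forall>j\<in>X. i \<noteq> j \<longrightarrow> \<Gamma> i j = 0"
  shows "\<exists>gates. length gates = card (X \<union> Y) + card (edges (X \<union> Y) \<Gamma>) \<and>
    set gates \<subseteq> elementary_gates d V \<and>
    (\<forall>\<psi>\<in>l2 d V. fourier_set d V X (diag_op d V (graph_phase d \<Gamma> (X \<union> Y)) (fourier_set d V Y \<psi>))
      = foldr (\<circ>) gates id \<psi>)"
proof -
  have V: "finite V" using assms by (simp add: weighted_graph_def)
  have "finite X" using assms(2) V by (meson finite_subset le_sup_iff)
  then show ?thesis using assms(2-4)
  proof (induction X)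
    case empty
    then have "Y \<subseteq> V" by simp
    from output_circuit [OF assms(1) this, of d] show ?case
      by (simp only: Un_empty_left fourier_set_empty id_def)
  next
    case (insert m X)
    let ?A = "X \<union> Y"
    let ?W = "nbrs \<Gamma> m ?A" and ?DA = "diag_op d V (graph_phase d \<Gamma> ?A)"
    let ?DW = "diag_op d V (fan_phase d \<Gamma> m ?W)"
    obtain gs where gs: "length gs = card ?A + card (edges ?A \<Gamma>)" "set gs \<subseteq> elementary_gates d V"
      "\<And>\<psi>. \<psi> \<in> l2 d V \<Longrightarrow> fourier_set d V X (?DA (fourier_set d V Y \<psi>)) = foldr (\<circ>) gs id \<psi>"
    proof -
      have "X \<union> Y \<subseteq> V" "X \<inter> Y = {}" "\<forall>i\<in>X. \<forall>j\<in>X. i \<noteq> j \<longrightarrow> \<Gamma> i j = 0"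
        using insert.prems by auto
      then show thesis using insert.IH that by blast
    qed
    have m: "m \<in> V" "?W \<subseteq> V" "m \<notin> ?W" and mA: "insert m ?A \<subseteq> V" "m \<notin> ?A"
      using insert.prems insert.hyps by (auto simp: nbrs_def)
    \<comment> \<open>All neighbours of \<open>m\<close> are outputs: an edge from \<open>m\<close>
      to an element of \<open>X\<close> would join two inputs.\<close>
    have W: "?W \<subseteq> Y" using insert.prems insert.hyps by (auto simp: nbrs_def)
    obtain cs where cs: "length cs = card ?W" "set cs \<subseteq> elementary_gates d V"
      "fourier d V m \<circ> ?DW = foldr (\<circ>) cs id \<circ> fourier d V m"
      using fourier_fan_phase_gates [OF V m] by blast
    have D: "diag_op d V (graph_phase d \<Gamma> (insert m ?A)) = ?DW \<circ> ?DA"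
      unfolding diag_op_comp
      by (intro diag_op_cong) (simp add: graph_phase_insert [OF assms(1) mA] mult.commute)
    \<comment> \<open>The star phase reads only the entries at \<open>m\<close> and in
      \<open>Y\<close>, and a vertex of \<open>X\<close> is neither.\<close>
    have "fan_phase d \<Gamma> m ?W (k(i := h)) = fan_phase d \<Gamma> m ?W k" if "i \<in> X" for i k h
      using that W insert.prems insert.hyps by (auto simp: fan_phase_def intro!: prod.cong)
    then have "fourier_set d V X \<circ> ?DW = ?DW \<circ> fourier_set d V X"
      using insert.prems V by (intro fourier_set_diag_op_commute) auto
    then have "fourier_set d V X \<circ> (?DW \<circ> g) = ?DW \<circ> (fourier_set d V X \<circ> g)" for g :: "'a oper"
      by (simp only: comp_assoc [symmetric])
    moreover have "insert m X \<subseteq> V" using insert.prems by simp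
    ultimately have E: "fourier_set d V (insert m X) \<circ> diag_op d V (graph_phase d \<Gamma> (insert m ?A))
        = fourier d V m \<circ> ?DW \<circ> (fourier_set d V X \<circ> ?DA)"
      by (simp only: D fourier_set_insert [OF V _ insert.hyps(2)] comp_assoc)
    \<comment> \<open>The shifts come out to the left of the new transform, so \<open>cs\<close>
      stands first in the list.\<close>
    have eq: "fourier_set d V (insert m X) (diag_op d V (graph_phase d \<Gamma> (insert m X \<union> Y))
          (fourier_set d V Y \<psi>)) = foldr (\<circ>) (cs @ fourier d V m # gs) id \<psi>"
      if "\<psi> \<in> l2 d V" for \<psi>
      using gs(3) [OF that] fun_cong [OF E [unfolded cs(3)], of "fourier_set d V Y \<psi>"]
      by (simp add: foldr_comp_append del: foldr_append)
    have "card (insert m ?A) = Suc (card ?A)"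
      using mA V by (meson card_insert_disjoint finite_subset insert_subset)
    then have len: "length (cs @ fourier d V m # gs)
        = card (insert m X \<union> Y) + card (edges (insert m X \<union> Y) \<Gamma>)"
      and mem: "set (cs @ fourier d V m # gs) \<subseteq> elementary_gates d V"
      using gs(1,2) cs(1,2) card_edges_insert [OF assms(1) mA]
        fourier_mem_elementary_gates [OF m(1)] by simp_all
    show ?case
      by (intro exI [of _ "cs @ fourier d V m # gs"] conjI ballI len mem eq)
  qed
qed

section \<open>Conjugation of the cluster operator by the input transforms\<close>

lemma fourier_set_l2:
  assumes "finite V" and "A \<subseteq> V" and "\<psi> \<in> l2 d V"
  shows "fourier_set d V A \<psi> \<in> l2 d V"
  using finite_subset [OF assms(2,1)] assms(2)
proof (induction A)
  case (insert i A)
  then show ?case using assms(1) by (simp add: fourier_set_insert fourier_l2)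
qed (simp add: assms(3))

theorem mainTheorem3:
  fixes d v l :: nat and V X Y :: "'v set" and \<Gamma> :: "'v \<Rightarrow> 'v \<Rightarrow> int"
    and Err :: "'v oper set"
  assumes "d > 0"
    and "weighted_graph V \<Gamma>"
    and "V = X \<union> Y" and "X \<inter> Y = {}"
    and "graph_qecc d X Y \<Gamma> Err"
    and "card V = v"
    and "card (edges V \<Gamma>) = l"
    and "\<forall>i\<in>X. \<forall>j\<in>X. i \<noteq> j \<longrightarrow> \<Gamma> i j = 0"
  shows "\<exists>gates. length gates = v + l \<and> set gates \<subseteq> elementary_gates d V \<and>
    (\<forall>\<psi>\<in>l2 d V.
       (fourier_set d V X \<circ> cluster_op d V \<Gamma> \<circ> adj d V V (fourier_set d V X)) \<psi>
         = foldr (\<circ>) gates id \<psi>)"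
proof -
  have V: "finite V" using assms(2) by (simp add: weighted_graph_def)
  obtain gs where gs: "length gs = card V + card (edges V \<Gamma>)" "set gs \<subseteq> elementary_gates d V"
    "\<And>\<psi>. \<psi> \<in> l2 d V \<Longrightarrow> fourier_set d V X (diag_op d V (graph_phase d \<Gamma> V) (fourier_set d V Y \<psi>))
      = foldr (\<circ>) gs id \<psi>"
    using input_output_circuit [of V \<Gamma> X Y d] assms by blast
  have "(fourier_set d V X \<circ> cluster_op d V \<Gamma> \<circ> adj d V V (fourier_set d V X)) \<psi>
      = foldr (\<circ>) gs id \<psi>" if \<psi>: "\<psi> \<in> l2 d V" for \<psi>
  proof -
    let ?\<phi> = "adj d V V (fourier_set d V X) \<psi>"
    \<comment> \<open>The input transforms are put on the right, where they meet the adjoint from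
      the conjugation and cancel.\<close>
    have "fourier_set d V V = fourier_set d V Y \<circ> fourier_set d V X"
      using fourier_set_Un [OF V, of Y X d] assms(3,4) by (simp add: Un_commute Int_commute)
    then have "fourier_set d V V ?\<phi> = fourier_set d V Y \<psi>"
      using fourier_set_adj [OF V _ \<psi>, of X] assms(3) by simp
    moreover have "fourier_set d V Y \<psi> \<in> l2 d V"
      using fourier_set_l2 [OF V _ \<psi>, of Y] assms(3) by simp
    ultimately show ?thesis
      using cluster_op_apply [OF assms(2), of d ?\<phi>] gs(3) [OF \<psi>] by simp
  qed
  then show ?thesis using gs(1,2) assms(6,7) by blast
qed

end
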